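(* The set of Gödel numbers of sentences of the language of arithmetic that are true in the standard model $\omega$ is not definable in $\omega$; that is, there is no formula $\tau(v_0)$ of the language of arithmetic, with at most the free variable $v_0$, such that for every $i\in\omega$, $\tau(i)$ is true in $\omega$ if and only if $i$ is the Gödel number of a sentence true in $\omega$.
   Context: Fix a standard first-order language of arithmetic (with equality, constant $0$, unary function symbol $s$, binary function symbols $+,\cdot$, order $\le$ primitive or defined) and a standard Gödel numbering of its formulas. $\omega$ is the standard model of arithmetic. Inside formulas, $i$ stands for the numeral $s\cdots s0$ ($i$ occurrences of $s$). *)

theory Defs
  imports Main "HOL-Library.Nat_Bijection"
begin

datatype trm =
    Var nat
  | Zero
  | S trm
  | Plus trm trm
  | Times trm trm

datatype fm =
    Eq trm trm
  | Le trm trm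
  | Neg fm
  | Conj fm fm
  | Disj fm fm
  | Impl fm fm
  | Forall nat fm
  | Exists nat fm

primrec numeral_trm :: "nat \<Rightarrow> trm" where
  "numeral_trm 0 = Zero"
| "numeral_trm (Suc i) = S (numeral_trm i)"

primrec fv_trm :: "trm \<Rightarrow> nat set" where
  "fv_trm (Var x) = {x}"
| "fv_trm Zero = {}"
| "fv_trm (S t) = fv_trm t"
| "fv_trm (Plus t u) = fv_trm t \<union> fv_trm u"
| "fv_trm (Times t u) = fv_trm t \<union> fv_trm u"

primrec fv :: "fm \<Rightarrow> nat set" where
  "fv (Eq t u) = fv_trm t \<union> fv_trm u"
| "fv (Le t u) = fv_trm t \<union> fv_trm u"
| "fv (Neg p) = fv p"
| "fv (Conj p q) = fv p \<union> fv q"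
| "fv (Disj p q) = fv p \<union> fv q"
| "fv (Impl p q) = fv p \<union> fv q"
| "fv (Forall x p) = fv p - {x}"
| "fv (Exists x p) = fv p - {x}"

definition sentence :: "fm \<Rightarrow> bool" where
  "sentence p \<longleftrightarrow> fv p = {}"

primrec subst_trm :: "nat \<Rightarrow> trm \<Rightarrow> trm \<Rightarrow> trm" where
  "subst_trm x r (Var y) = (if y = x then r else Var y)"
| "subst_trm x r Zero = Zero"
| "subst_trm x r (S t) = S (subst_trm x r t)"
| "subst_trm x r (Plus t u) = Plus (subst_trm x r t) (subst_trm x r u)"
| "subst_trm x r (Times t u) = Times (subst_trm x r t) (subst_trm x r u)"

(* Replaces the free occurrences of x without renaming bound variables, so it
   is only meaningful when r cannot be captured. It is used below only with
   closed r (numerals). *)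
primrec subst :: "nat \<Rightarrow> trm \<Rightarrow> fm \<Rightarrow> fm" where
  "subst x r (Eq t u) = Eq (subst_trm x r t) (subst_trm x r u)"
| "subst x r (Le t u) = Le (subst_trm x r t) (subst_trm x r u)"
| "subst x r (Neg p) = Neg (subst x r p)"
| "subst x r (Conj p q) = Conj (subst x r p) (subst x r q)"
| "subst x r (Disj p q) = Disj (subst x r p) (subst x r q)"
| "subst x r (Impl p q) = Impl (subst x r p) (subst x r q)"
| "subst x r (Forall y p) = Forall y (if y = x then p else subst x r p)"
| "subst x r (Exists y p) = Exists y (if y = x then p else subst x r p)"

primrec omega_val :: "(nat \<Rightarrow> nat) \<Rightarrow> trm \<Rightarrow> nat" where
  "omega_val e (Var x) = e x"
| "omega_val e Zero = 0"
| "omega_val e (S t) = Suc (omega_val e t)"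
| "omega_val e (Plus t u) = omega_val e t + omega_val e u"
| "omega_val e (Times t u) = omega_val e t * omega_val e u"

primrec omega_sat :: "(nat \<Rightarrow> nat) \<Rightarrow> fm \<Rightarrow> bool" where
  "omega_sat e (Eq t u) \<longleftrightarrow> omega_val e t = omega_val e u"
| "omega_sat e (Le t u) \<longleftrightarrow> omega_val e t \<le> omega_val e u"
| "omega_sat e (Neg p) \<longleftrightarrow> \<not> omega_sat e p"
| "omega_sat e (Conj p q) \<longleftrightarrow> omega_sat e p \<and> omega_sat e q"
| "omega_sat e (Disj p q) \<longleftrightarrow> omega_sat e p \<or> omega_sat e q"
| "omega_sat e (Impl p q) \<longleftrightarrow> (omega_sat e p \<longrightarrow> omega_sat e q)"
| "omega_sat e (Forall x p) \<longleftrightarrow> (\<forall>n. omega_sat (e(x := n)) p)"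
| "omega_sat e (Exists x p) \<longleftrightarrow> (\<exists>n. omega_sat (e(x := n)) p)"

definition omega_true :: "fm \<Rightarrow> bool" where
  "omega_true p \<longleftrightarrow> (\<forall>e. omega_sat e p)"

(* Goedel numbering by recursion on syntax: an expression is coded as the
   Cantor pair of a tag for its outermost symbol and the codes of its parts. *)
primrec gn_trm :: "trm \<Rightarrow> nat" where
  "gn_trm (Var x) = prod_encode (0, x)"
| "gn_trm Zero = prod_encode (1, 0)"
| "gn_trm (S t) = prod_encode (2, gn_trm t)"
| "gn_trm (Plus t u) = prod_encode (3, prod_encode (gn_trm t, gn_trm u))"
| "gn_trm (Times t u) = prod_encode (4, prod_encode (gn_trm t, gn_trm u))"

primrec gn :: "fm \<Rightarrow> nat" where
  "gn (Eq t u) = prod_encode (5, prod_encode (gn_trm t, gn_trm u))"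
| "gn (Le t u) = prod_encode (6, prod_encode (gn_trm t, gn_trm u))"
| "gn (Neg p) = prod_encode (7, gn p)"
| "gn (Conj p q) = prod_encode (8, prod_encode (gn p, gn q))"
| "gn (Disj p q) = prod_encode (9, prod_encode (gn p, gn q))"
| "gn (Impl p q) = prod_encode (10, prod_encode (gn p, gn q))"
| "gn (Forall x p) = prod_encode (11, prod_encode (x, gn p))"
| "gn (Exists x p) = prod_encode (12, prod_encode (x, gn p))"

lemma gn_trm_eq_iff: "gn_trm t = gn_trm u \<longleftrightarrow> t = u"
proof (induction t arbitrary: u)
  case (Var x) then show ?case by (cases u) auto
next
  case Zero then show ?case by (cases u) auto
next
  case (S t) then show ?case by (cases u) auto
next
  case (Plus t1 t2) then show ?case by (cases u) auto
next
  case (Times t1 t2) then show ?case by (cases u) auto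
qed

lemma gn_eq_iff: "gn p = gn q \<longleftrightarrow> p = q"
proof (induction p arbitrary: q)
  case (Eq t u) then show ?case by (cases q) (auto simp: gn_trm_eq_iff)
next
  case (Le t u) then show ?case by (cases q) (auto simp: gn_trm_eq_iff)
next
  case (Neg p) then show ?case by (cases q) auto
next
  case (Conj p1 p2) then show ?case by (cases q) auto
next
  case (Disj p1 p2) then show ?case by (cases q) auto
next
  case (Impl p1 p2) then show ?case by (cases q) auto
next
  case (Forall x p) then show ?case by (cases q) auto
next
  case (Exists x p) then show ?case by (cases q) auto
qed

definition definable_in_omega :: "nat set \<Rightarrow> bool" where
  "definable_in_omega A \<longleftrightarrow>
     (\<exists>\<tau>. fv \<tau> \<subseteq> {0} \<and>
        (\<forall>i. omega_true (subst 0 (numeral_trm i) \<tau>) \<longleftrightarrow> i \<in> A))"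

end

theory Submission
  imports Defs "HOL-Number_Theory.Cong"
begin

text \<open>
  Suppose \<open>\<tau>\<close> defines truth. Instead of the usual substitution function, diagonalise with
  \<open>\<exists>v\<^sub>0. v\<^sub>0 = n \<and> \<phi>\<close>, where \<open>n\<close> is the code of \<open>\<phi>\<close>: its code is obtained from \<open>n\<close> and the code of the
  numeral of \<open>n\<close> by Cantor pairing, whose graph is given by a polynomial equation. Hence only the
  recursion computing codes of numerals has to be eliminated, which Goedel's beta function does.
\<close>

section \<open>Assignments and substitution of numerals\<close>

lemma fv_numeral_trm [simp]: "fv_trm (numeral_trm n) = {}"
  by (induction n) auto

lemma omega_val_numeral [simp]: "omega_val e (numeral_trm n) = n"
  by (induction n) auto

lemma omega_val_cong: "(\<And>x. x \<in> fv_trm t \<Longrightarrow> e x = e' x) \<Longrightarrow> omega_val e t = omega_val e' t"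
  by (induction t) auto

lemma omega_sat_cong: "(\<And>x. x \<in> fv p \<Longrightarrow> e x = e' x) \<Longrightarrow> omega_sat e p \<longleftrightarrow> omega_sat e' p"
proof (induction p arbitrary: e e')
  case (Eq t u)
  then show ?case using omega_val_cong[of t e e'] omega_val_cong[of u e e'] by simp
next
  case (Le t u)
  then show ?case using omega_val_cong[of t e e'] omega_val_cong[of u e e'] by simp
next
  case (Forall x p)
  have "omega_sat (e(x := n)) p \<longleftrightarrow> omega_sat (e'(x := n)) p" for n
    by (rule Forall.IH) (simp add: Forall.prems)
  then show ?case by simp
next
  case (Exists x p)
  have "omega_sat (e(x := n)) p \<longleftrightarrow> omega_sat (e'(x := n)) p" for n
    by (rule Exists.IH) (simp add: Exists.prems)
  then show ?case by simp
next
  case (Neg p)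
  show ?case using Neg.IH[of e e'] Neg.prems by simp
next
  case (Conj p q)
  show ?case using Conj.IH(1)[of e e'] Conj.IH(2)[of e e'] Conj.prems by simp
next
  case (Disj p q)
  show ?case using Disj.IH(1)[of e e'] Disj.IH(2)[of e e'] Disj.prems by simp
next
  case (Impl p q)
  show ?case using Impl.IH(1)[of e e'] Impl.IH(2)[of e e'] Impl.prems by simp
qed

lemma omega_val_subst_trm:
  "omega_val e (subst_trm x (numeral_trm i) t) = omega_val (e(x := i)) t"
  by (induction t) auto

lemma omega_sat_subst:
  "omega_sat e (subst x (numeral_trm i) p) \<longleftrightarrow> omega_sat (e(x := i)) p"
  by (induction p arbitrary: e) (auto simp: omega_val_subst_trm fun_upd_twist)

section \<open>Cantor pairing, Goedel's beta function and codes of numerals\<close>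

definition pair_fm :: "trm \<Rightarrow> trm \<Rightarrow> trm \<Rightarrow> fm" where
  "pair_fm a b c = Eq (Plus c c) (Plus (Times (Plus a b) (S (Plus a b))) (Plus a a))"

lemma fv_pair_fm [simp]: "fv (pair_fm a b c) = fv_trm a \<union> fv_trm b \<union> fv_trm c"
  by (auto simp: pair_fm_def)

lemma double_triangle: "2 * triangle n = n * Suc n"
  by (induction n) auto

text \<open>\<open>pair_fm\<close> is Cantor's equation c = (a+b)(a+b+1)/2 + a, doubled to avoid the
  division.\<close>

lemma omega_sat_pair_fm [simp]:
  "omega_sat e (pair_fm a b c) \<longleftrightarrow>
     omega_val e c = prod_encode (omega_val e a, omega_val e b)"
  using double_triangle[of "omega_val e a + omega_val e b"]
  by (simp add: pair_fm_def prod_encode_def del: mult_Suc_right) linarith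

text \<open>Variable 3 is bound here, so it must not occur in the arguments.\<close>

definition beta_fm :: "trm \<Rightarrow> trm \<Rightarrow> trm \<Rightarrow> trm \<Rightarrow> fm" where
  "beta_fm c d i z =
     Exists 3 (Conj (Eq c (Plus (Times (S (Times (S i) d)) (Var 3)) z)) (Le z (Times (S i) d)))"

definition beta :: "nat \<Rightarrow> nat \<Rightarrow> nat \<Rightarrow> nat" where
  "beta c d i = c mod Suc (Suc i * d)"

lemma fv_beta_fm:
  "fv (beta_fm c d i z) = fv_trm c \<union> fv_trm d \<union> fv_trm i \<union> fv_trm z - {3}"
  by (auto simp: beta_fm_def)

lemma omega_sat_beta_fm:
  assumes "3 \<notin> fv_trm c \<union> fv_trm d \<union> fv_trm i \<union> fv_trm z"
  shows "omega_sat e (beta_fm c d i z) \<longleftrightarrow>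
    omega_val e z = beta (omega_val e c) (omega_val e d) (omega_val e i)"
proof -
  have upd: "omega_val (e(3 := n)) t = omega_val e t" if "3 \<notin> fv_trm t" for n t
    using that by (intro omega_val_cong) auto
  \<comment> \<open>The bound z \<le> m says z < \<open>Suc m\<close>, so q and z are quotient and
    remainder.\<close>
  have "(\<exists>q. c = Suc m * q + z \<and> z \<le> m) \<longleftrightarrow> z = c mod Suc m" for c m z
  proof
    assume "\<exists>q. c = Suc m * q + z \<and> z \<le> m"
    then show "z = c mod Suc m" by (metis le_imp_less_Suc mod_less mod_mult_self4)
  next
    assume z: "z = c mod Suc m"
    then have "c = Suc m * (c div Suc m) + z" "z \<le> m"
      using mod_less_divisor[of "Suc m" c] by (auto simp del: mult_Suc simp: less_Suc_eq_le)
    then show "\<exists>q. c = Suc m * q + z \<and> z \<le> m" by blast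
  qed
  then show ?thesis
    using assms by (simp add: beta_fm_def beta_def upd del: mult_Suc)
qed

text \<open>A common divisor is coprime to \<open>fact N\<close>, as each modulus is 1 plus a
  multiple of it. It divides the difference \<open>(j - i) * fact N\<close>, hence j - i, hence
  \<open>fact N\<close>, so it is a unit.\<close>

lemma coprime_beta_moduli:
  fixes i j d N :: nat
  assumes "i < j" "j \<le> N"
  shows "coprime (Suc (Suc i * fact N)) (Suc (Suc j * fact N))"
proof (rule coprimeI)
  fix k :: nat
  assume i: "k dvd Suc (Suc i * fact N)" and j: "k dvd Suc (Suc j * fact N)"
  have "coprime k (fact N)"
  proof (rule coprimeI)
    fix l assume "l dvd k" "l dvd fact N"
    then have "l dvd Suc (Suc i * fact N)" "l dvd Suc i * fact N"
      using i dvd_trans dvd_mult by blast+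
    then show "is_unit l"
      by (metis Suc_eq_plus1 dvd_add_right_iff)
  qed
  moreover have "k dvd (j - i) * fact N"
    using dvd_diff_nat[OF j i] assms by (simp add: diff_mult_distrib)
  ultimately have "k dvd j - i"
    using coprime_dvd_mult_left_iff by blast
  moreover have "j - i dvd fact N"
    using assms by (intro dvd_fact) auto
  ultimately show "is_unit k"
    using \<open>coprime k (fact N)\<close> by (meson coprime_common_divisor dvd_refl dvd_trans)
qed

lemma beta_exists:
  fixes f :: "nat \<Rightarrow> nat"
  shows "\<exists>c d. \<forall>i\<le>n. beta c d i = f i"
proof -
  \<comment> \<open>N bounds the indices, for coprimality of the moduli, and the values, so that
    each value is below its modulus and equals the remainder.\<close>
  define N where "N = n + (\<Sum>i\<le>n. f i)"
  define m where "m i = Suc (Suc i * fact N)" for i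
  have "\<forall>i\<in>{..n}. \<forall>j\<in>{..n}. i \<noteq> j \<longrightarrow> coprime (m i) (m j)"
  proof (intro ballI impI)
    fix i j assume "i \<in> {..n}" "j \<in> {..n}" "i \<noteq> j"
    then show "coprime (m i) (m j)"
      using coprime_beta_moduli[of i j N] coprime_beta_moduli[of j i N]
      unfolding m_def N_def by (metis atMost_iff coprime_commute linorder_neqE_nat trans_le_add1)
  qed
  then obtain c where c: "\<forall>i\<in>{..n}. [c = f i] (mod m i)"
    using chinese_remainder_nat[of "{..n}" m f] by auto
  have "beta c (fact N) i = f i" if "i \<le> n" for i
  proof -
    have "f i \<le> N"
      using that member_le_sum[of i "{..n}" f] by (simp add: N_def trans_le_add2)
    also have "N \<le> fact N"
      by (rule fact_ge_self)
    finally have "f i < m i"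
      by (simp add: m_def)
    then show ?thesis
      using c that by (simp add: beta_def m_def cong_def del: mult_Suc)
  qed
  then show ?thesis by blast
qed

text \<open>The first constant 2 is the code of \<^term>\<open>Zero\<close>, the second one the tag of \<^term>\<open>S\<close>.\<close>

definition numeral_code_fm :: fm where
  "numeral_code_fm = Exists 1 (Exists 2 (Conj
     (beta_fm (Var 1) (Var 2) Zero (numeral_trm 2)) (Conj
     (Forall 4 (Impl (Le (S (Var 4)) (Var 0))
       (Exists 5 (Exists 6 (Conj (beta_fm (Var 1) (Var 2) (Var 4) (Var 5)) (Conj
         (beta_fm (Var 1) (Var 2) (S (Var 4)) (Var 6))
         (pair_fm (numeral_trm 2) (Var 5) (Var 6))))))))
     (beta_fm (Var 1) (Var 2) (Var 0) (Var 7)))))"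

lemma fv_numeral_code_fm: "fv numeral_code_fm = {0, 7}"
  by (auto simp: numeral_code_fm_def fv_beta_fm)

lemma gn_trm_Zero: "gn_trm Zero = 2"
  by (simp add: prod_encode_def triangle_def)

text \<open>By induction along the recursion, any witnesses c and d list the codes of the numerals
  up to \<open>e 0\<close>. Conversely, \<open>beta_exists\<close> supplies witnesses for that
  list.\<close>

lemma omega_sat_numeral_code_fm:
  "omega_sat e numeral_code_fm \<longleftrightarrow> e 7 = gn_trm (numeral_trm (e 0))"
proof -
  have "omega_sat e numeral_code_fm \<longleftrightarrow>
      (\<exists>c d. beta c d 0 = 2 \<and> (\<forall>i < e 0. beta c d (Suc i) = prod_encode (2, beta c d i)) \<and>
        e 7 = beta c d (e 0))"
    by (simp add: numeral_code_fm_def omega_sat_beta_fm Suc_le_eq eq_commute[of 2 "beta _ _ _"])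
  also have "\<dots> \<longleftrightarrow> e 7 = gn_trm (numeral_trm (e 0))"
  proof
    assume "\<exists>c d. beta c d 0 = 2 \<and> (\<forall>i < e 0. beta c d (Suc i) = prod_encode (2, beta c d i)) \<and>
        e 7 = beta c d (e 0)"
    then obtain c d where cd: "beta c d 0 = 2"
      "\<forall>i < e 0. beta c d (Suc i) = prod_encode (2, beta c d i)" "e 7 = beta c d (e 0)"
      by blast
    have "i \<le> e 0 \<Longrightarrow> beta c d i = gn_trm (numeral_trm i)" for i
      by (induction i) (use cd gn_trm_Zero in auto)
    with cd show "e 7 = gn_trm (numeral_trm (e 0))" by simp
  next
    assume e7: "e 7 = gn_trm (numeral_trm (e 0))"
    obtain c d where cd: "\<And>i. i \<le> e 0 \<Longrightarrow> beta c d i = gn_trm (numeral_trm i)"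
      using beta_exists[of "e 0" "\<lambda>i. gn_trm (numeral_trm i)"] by blast
    have "beta c d 0 = 2" "e 7 = beta c d (e 0)"
      using cd e7 gn_trm_Zero by simp_all
    moreover have "beta c d (Suc i) = prod_encode (2, beta c d i)" if "i < e 0" for i
      using cd[of i] cd[of "Suc i"] that by simp
    ultimately show "\<exists>c d. beta c d 0 = 2 \<and> (\<forall>i < e 0. beta c d (Suc i) = prod_encode (2, beta c d i)) \<and>
        e 7 = beta c d (e 0)"
      by blast
  qed
  finally show ?thesis .
qed

section \<open>The diagonal sentence\<close>

definition instance_fm :: "nat \<Rightarrow> fm \<Rightarrow> fm" where
  "instance_fm n p = Exists 0 (Conj (Eq (Var 0) (numeral_trm n)) p)"

text \<open>\<open>diag_fm\<close> replays these pairings from the inside out. The 0 below tag 5 is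
  the code of \<open>Var 0\<close>, since (0, 0) is paired to 0; the 0 below tag 12 is the bound
  variable.\<close>

lemma gn_instance_fm:
  "gn (instance_fm n p) =
    prod_encode (12, prod_encode (0, prod_encode (8, prod_encode
      (prod_encode (5, prod_encode (0, gn_trm (numeral_trm n))), gn p))))"
  by (simp add: instance_fm_def prod_encode_def)

lemma omega_sat_instance_fm: "omega_sat e (instance_fm n p) \<longleftrightarrow> omega_sat (e(0 := n)) p"
  by (simp add: instance_fm_def)

text \<open>Rebinding variable 0 in the last conjunct replaces the substitution of variable 14
  into \<open>\<tau>\<close>, so that no capture can occur.\<close>

definition diag_fm :: "fm \<Rightarrow> fm" where
  "diag_fm \<tau> = Exists 7 (Conj numeral_code_fm
    (Exists 8 (Conj (pair_fm Zero (Var 7) (Var 8))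
    (Exists 9 (Conj (pair_fm (numeral_trm 5) (Var 8) (Var 9))
    (Exists 10 (Conj (pair_fm (Var 9) (Var 0) (Var 10))
    (Exists 11 (Conj (pair_fm (numeral_trm 8) (Var 10) (Var 11))
    (Exists 12 (Conj (pair_fm Zero (Var 11) (Var 12))
    (Exists 14 (Conj (pair_fm (numeral_trm 12) (Var 12) (Var 14))
    (Exists 0 (Conj (Eq (Var 0) (Var 14)) (Neg \<tau>))))))))))))))))"

lemma fv_diag_fm: "fv \<tau> \<subseteq> {0} \<Longrightarrow> fv (diag_fm \<tau>) \<subseteq> {0}"
  by (auto simp: diag_fm_def fv_numeral_code_fm)

lemma omega_sat_diag_fm:
  assumes "fv \<tau> \<subseteq> {0}" and "gn p = e 0"
  shows "omega_sat e (diag_fm \<tau>) \<longleftrightarrow> \<not> omega_sat (e(0 := gn (instance_fm (e 0) p))) \<tau>"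
proof -
  define P where "P \<longleftrightarrow> omega_sat (e(0 := gn (instance_fm (e 0) p))) \<tau>"
  \<comment> \<open>Evaluating \<open>diag_fm\<close> also changes variables 7 to 12 and 14, none of
    them free in \<tau>, so only the value at 0 matters.\<close>
  have "omega_sat e' \<tau> \<longleftrightarrow> P" if "e' 0 = gn (instance_fm (e 0) p)" for e'
    unfolding P_def using that assms(1) by (intro omega_sat_cong) auto
  then show ?thesis
    unfolding P_def[symmetric] using assms(2)
    by (simp add: diag_fm_def omega_sat_numeral_code_fm gn_instance_fm)
qed

theorem corollary2:
  shows "\<not> definable_in_omega {gn \<phi> | \<phi>. sentence \<phi> \<and> omega_true \<phi>}"
proof
  assume "definable_in_omega {gn \<phi> | \<phi>. sentence \<phi> \<and> omega_true \<phi>}"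
  then obtain \<tau> where fv: "fv \<tau> \<subseteq> {0}" and
    \<tau>: "\<And>i. omega_true (subst 0 (numeral_trm i) \<tau>) \<longleftrightarrow>
          i \<in> {gn \<phi> | \<phi>. sentence \<phi> \<and> omega_true \<phi>}"
    unfolding definable_in_omega_def by blast
  \<comment> \<open>Applying the diagonal formula to its own code makes G say that \<tau> fails at
    the code of G.\<close>
  define n where "n = gn (diag_fm \<tau>)"
  define G where "G = instance_fm n (diag_fm \<tau>)"
  have "sentence G"
    using fv_diag_fm[OF fv] by (auto simp: G_def instance_fm_def sentence_def)
  have "omega_sat e G \<longleftrightarrow> \<not> omega_sat (e(0 := gn G)) \<tau>" for e
    using omega_sat_diag_fm[OF fv, of "diag_fm \<tau>" "e(0 := n)"]
    by (simp add: G_def omega_sat_instance_fm n_def)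
  \<comment> \<open>\<open>omega_true\<close> quantifies over all assignments; independence of e is
    what lets the negation pass through it.\<close>
  moreover have "omega_sat (e(0 := gn G)) \<tau> \<longleftrightarrow> omega_true (subst 0 (numeral_trm (gn G)) \<tau>)" for e
  proof -
    have "omega_sat (e'(0 := gn G)) \<tau> \<longleftrightarrow> omega_sat (e(0 := gn G)) \<tau>" for e'
      using fv by (intro omega_sat_cong) auto
    then show ?thesis
      unfolding omega_true_def omega_sat_subst by blast
  qed
  ultimately have "omega_true G \<longleftrightarrow> \<not> omega_true (subst 0 (numeral_trm (gn G)) \<tau>)"
    by (simp add: omega_true_def)
  moreover have "omega_true (subst 0 (numeral_trm (gn G)) \<tau>) \<longleftrightarrow> omega_true G"
    \<comment> \<open>Injectivity of \<open>gn\<close> is essential: the true sentence sharing its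
      code with G must be G itself.\<close>
    using \<tau> \<open>sentence G\<close> by (auto simp: gn_eq_iff)
  ultimately show False by blast
qed

end
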